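(* Let $k\in[0,3)$ and let $q,q_1,q_2\in\mathbb{R}$. (i) When $k\in[23/17,3)$, the inequality $$\frac{\sinh x}{x}>\left(1-\frac k3+\frac k3\cosh^q x\right)^{1/(kq)}$$ holds for all $x\in(0,\infty)$ if and only if $q\le \frac{8}{5(3-k)}$. (ii) When $k\in[0,1]$, the double inequality $$\left(1-\frac k3+\frac k3\cosh^{q_1}x\right)^{1/(kq_1)}<\frac{\sinh x}{x}<\left(1-\frac k3+\frac k3\cosh^{q_2}x\right)^{1/(kq_2)}$$ holds for all $x\in(0,\infty)$ if and only if $q_1\le0$ and $q_2\ge\frac{8}{5(3-k)}$.
   Context: Convention: for zero parameters the expression $\left(1-\frac k3+\frac k3 t^{q}\right)^{1/(kq)}$ (with $t>1$) is understood as the corresponding limit: it means $\exp\frac{t^q-1}{3q}$ if $k=0$, $q\ne0$, and $t^{1/3}$ if $q=0$. *)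

theory Defs
  imports Complex_Main
begin

text \<open>
  The expression \<open>(1 - k/3 + (k/3) t^q)^(1/(kq))\<close>, for \<open>t > 1\<close> and \<open>0 \<le> k < 3\<close>, where a zero
  parameter is read as the corresponding limit (with \<open>1 / 0 = 0\<close> the bare formula would give
  \<open>1\<close> there). Under these constraints both bases of \<open>powr\<close> are positive.
\<close>

definition power_expr :: "real \<Rightarrow> real \<Rightarrow> real \<Rightarrow> real" where
  "power_expr k q t =
     (if q = 0 then t powr (1 / 3)
      else if k = 0 then exp ((t powr q - 1) / (3 * q))
      else (1 - k / 3 + k / 3 * t powr q) powr (1 / (k * q)))"

end

theory Submission
  imports Defs
begin

text \<open>
  In all cases, including the limiting ones, the logarithm of the right-hand side vanishes at
  \<open>t = 1\<close> and has derivative \<open>1 / (3 P(t))\<close>, where \<open>P(t) = (1 - k/3) t^(1-q) + (k/3) t\<close>. Hence two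
  such expressions are compared by comparing their \<open>P\<close>: the expression increases with \<open>q\<close>, and it
  decreases with \<open>k\<close> along the critical curve \<open>q = 8 / (5 (3 - k))\<close>. Sufficiency is thereby reduced
  to \<open>k = 23/17\<close>, \<open>k = 1\<close> and \<open>q = 0\<close>.

  Put \<open>t = cosh x\<close>, \<open>s = sinh x\<close>, \<open>D = 3 t P - s^2\<close>. The derivative in \<open>x\<close> of the difference of the
  logarithms of the two sides has the sign of \<open>3 s P / D - x\<close>, which vanishes at \<open>0\<close> and whose
  derivative is \<open>s^2 C(t) / D^2\<close> with \<open>C = 9 P (t - P) - (t^2 - 1) (1 + 3 P')\<close>. In the cases
  \<open>k = 1\<close> and \<open>k = 23/17\<close> this \<open>C\<close> is, up to a positive or negative factor, a polynomial in
  \<open>t^(2/5)\<close> or \<open>t^(2/35)\<close> that is positive on \<open>(1, \<infinity>)\<close>. Since \<open>C(1) = 0\<close> and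
  \<open>C'(1) = 5 q (3 - k) - 8\<close>, the same argument near \<open>x = 0\<close> shows that the critical exponent is sharp.
\<close>

section \<open>The logarithmic derivative of the power expression\<close>

text \<open>This is \<open>P\<close> of the overview. It covers the limiting cases without a case
  split: for positive \<open>t\<close> it is \<open>t\<close> when \<open>q = 0\<close> and
  \<open>t powr (1 - q)\<close> when \<open>k = 0\<close>.\<close>

definition mean_den :: "real \<Rightarrow> real \<Rightarrow> real \<Rightarrow> real" where
  "mean_den k q t = (1 - k / 3) * t powr (1 - q) + k / 3 * t"

definition mean_den_deriv :: "real \<Rightarrow> real \<Rightarrow> real \<Rightarrow> real" where
  "mean_den_deriv k q t = (1 - k / 3) * (1 - q) * t powr (- q) + k / 3"

text \<open>This is \<open>C\<close> of the overview, with s^2 written as t^2 - 1 so that only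
  \<open>t\<close> remains.\<close>

definition crit :: "real \<Rightarrow> real \<Rightarrow> real \<Rightarrow> real" where
  "crit k q t = 9 * mean_den k q t * (t - mean_den k q t)
                - (t\<^sup>2 - 1) * (1 + 3 * mean_den_deriv k q t)"

lemma power_expr_pos:
  assumes "0 \<le> k" "k < 3" "t > 0"
  shows "power_expr k q t > 0"
proof -
  have "1 - k / 3 + k / 3 * t powr q > 0"
    using assms by (intro add_pos_nonneg) auto
  then show ?thesis using assms by (simp add: power_expr_def)
qed

lemma power_expr_1: "power_expr k q 1 = 1"
  by (simp add: power_expr_def)

lemma mean_den_pos:
  assumes "0 \<le> k" "k < 3" "t > 0"
  shows "mean_den k q t > 0"
  unfolding mean_den_def using assms by (intro add_pos_nonneg) auto

lemma mean_den_1 [simp]: "mean_den k q 1 = 1"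
  by (simp add: mean_den_def)

lemma DERIV_mean_den:
  assumes "t > 0"
  shows "(mean_den k q has_real_derivative mean_den_deriv k q t) (at t)"
  unfolding mean_den_def mean_den_deriv_def
  using assms by (auto intro!: derivative_eq_intros simp: field_simps)

text \<open>The three branches are differentiated separately. In the generic one,
  \<open>mean_den\<close> times \<open>t powr q\<close> equals \<open>t\<close> times the base of
  the power, which collapses the chain rule to 1 / (3 P).\<close>

lemma DERIV_ln_power_expr:
  assumes "0 \<le> k" "k < 3" "t > 0"
  shows "((\<lambda>t. ln (power_expr k q t)) has_real_derivative 1 / (3 * mean_den k q t)) (at t)"
proof -
  consider "q = 0" | "q \<noteq> 0" "k = 0" | "q \<noteq> 0" "k > 0"
    using assms by fastforce
  then show ?thesis
  proof cases
    case 1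
    then show ?thesis
      using assms
      by (auto intro!: derivative_eq_intros simp: power_expr_def mean_den_def field_simps)
  next
    case 2
    then show ?thesis
      using assms
      by (auto intro!: derivative_eq_intros simp: power_expr_def mean_den_def field_simps powr_diff)
  next
    case 3
    define b where "b = 1 - k / 3 + k / 3 * t powr q"
    have b: "b > 0"
      unfolding b_def using assms by (intro add_pos_nonneg) auto
    have den: "mean_den k q t * t powr q = t * b"
      using assms by (simp add: mean_den_def b_def powr_diff field_simps)
    have mp: "mean_den k q t > 0" using mean_den_pos assms by blast
    have tp: "t powr q > 0" using assms by simp
    have "((\<lambda>t. (1 / (k * q)) * ln (1 - k / 3 + k / 3 * t powr q)) has_real_derivative
           (1 / (k * q)) * ((k / 3 * (q * t powr (q - 1))) / b)) (at t)"
      using assms b unfolding b_def by (auto intro!: derivative_eq_intros)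
    also have "(1 / (k * q)) * ((k / 3 * (q * t powr (q - 1))) / b) = t powr q / (3 * (t * b))"
      using 3 assms b by (simp add: powr_diff field_simps)
    also have "\<dots> = 1 / (3 * mean_den k q t)"
      unfolding den [symmetric] using tp mp by simp
    finally show ?thesis
      using 3 by (simp add: power_expr_def ln_powr)
  qed
qed

section \<open>Comparison of power expressions with different parameters\<close>

text \<open>Both logarithms start at 0 for \<open>t = 1\<close>, and the smaller
  \<open>mean_den\<close> gives the larger slope.\<close>

lemma power_expr_mono:
  assumes "0 \<le> k" "k < 3" "0 \<le> k'" "k' < 3" "t \<ge> 1"
    and le: "\<And>s. s \<ge> 1 \<Longrightarrow> mean_den k' q' s \<le> mean_den k q s"
  shows "power_expr k q t \<le> power_expr k' q' t"
proof -
  have "ln (power_expr k' q' 1) - ln (power_expr k q 1)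
        \<le> ln (power_expr k' q' t) - ln (power_expr k q t)"
  proof (rule DERIV_nonneg_imp_nondecreasing [OF \<open>t \<ge> 1\<close>])
    fix s :: real assume "1 \<le> s"
    then have p: "mean_den k' q' s > 0" "mean_den k q s > 0"
      using assms by (auto intro!: mean_den_pos)
    have "((\<lambda>s. ln (power_expr k' q' s) - ln (power_expr k q s)) has_real_derivative
            1 / (3 * mean_den k' q' s) - 1 / (3 * mean_den k q s)) (at s)"
      using \<open>1 \<le> s\<close> assms by (auto intro!: DERIV_diff DERIV_ln_power_expr)
    moreover have "1 / (3 * mean_den k' q' s) - 1 / (3 * mean_den k q s) \<ge> 0"
      using p le [OF \<open>1 \<le> s\<close>] by (simp add: frac_le)
    ultimately show "\<exists>y. ((\<lambda>s. ln (power_expr k' q' s) - ln (power_expr k q s))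
                        has_real_derivative y) (at s) \<and> 0 \<le> y"
      by blast
  qed
  then have "ln (power_expr k q t) \<le> ln (power_expr k' q' t)"
    by (simp add: power_expr_1)
  then show ?thesis
    using assms by (simp add: power_expr_pos)
qed

lemma power_expr_mono_exponent:
  assumes "0 \<le> k" "k < 3" "t \<ge> 1" "q \<le> q'"
  shows "power_expr k q t \<le> power_expr k q' t"
  using assms
  by (intro power_expr_mono) (auto simp: mean_den_def intro!: mult_left_mono powr_mono)

text \<open>For \<open>q \<ge> 0\<close>, \<open>mean_den\<close> is a weighted mean of
  \<open>s powr (1 - q)\<close> and the larger \<open>s\<close>, and raising the weight shifts it
  towards \<open>s\<close>.\<close>

lemma power_expr_antimono_weight:
  assumes "0 \<le> k" "k \<le> k'" "k' < 3" "t \<ge> 1" "q \<ge> 0"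
  shows "power_expr k' q t \<le> power_expr k q t"
proof (rule power_expr_mono)
  fix s :: real assume "s \<ge> 1"
  then have "s powr (1 - q) \<le> s powr 1"
    using assms by (intro powr_mono) auto
  with \<open>s \<ge> 1\<close> have "(k' / 3 - k / 3) * (s - s powr (1 - q)) \<ge> 0"
    using assms by (intro mult_nonneg_nonneg) auto
  then show "mean_den k q s \<le> mean_den k' q s"
    by (simp add: mean_den_def algebra_simps)
qed (use assms in auto)

text \<open>With u = c / x the derivative is 1 - exp(-u) (1 + u), which is nonnegative because 1 + u
  is at most exp(u). The lemma serves the critical curve, with 1 - k/3 in the role of
  \<open>a\<close>.\<close>

lemma mult_one_minus_exp_mono:
  fixes a b c :: real
  assumes "0 < a" "a \<le> b" "c \<ge> 0"
  shows "a * (1 - exp (- c / a)) \<le> b * (1 - exp (- c / b))"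
proof (rule DERIV_nonneg_imp_nondecreasing [OF \<open>a \<le> b\<close>])
  fix x assume "a \<le> x" "x \<le> b"
  with assms have x: "x > 0" by simp
  have "((\<lambda>a. a * (1 - exp (- c / a))) has_real_derivative
          1 - exp (- c / x) * (1 + c / x)) (at x)"
    using x by (auto intro!: derivative_eq_intros simp: field_simps power2_eq_square)
  moreover have "exp (- c / x) * (1 + c / x) \<le> exp (- c / x) * exp (c / x)"
    by (intro mult_left_mono exp_ge_add_one_self) auto
  then have "1 - exp (- c / x) * (1 + c / x) \<ge> 0"
    by (simp add: exp_minus)
  ultimately show "\<exists>y. ((\<lambda>a. a * (1 - exp (- c / a))) has_real_derivative y) (at x) \<and> 0 \<le> y"
    by blast
qed

lemma power_expr_critical_antimono:
  assumes "0 \<le> k" "k \<le> k'" "k' < 3" "t \<ge> 1"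
  shows "power_expr k' (8 / (5 * (3 - k'))) t \<le> power_expr k (8 / (5 * (3 - k))) t"
proof (rule power_expr_mono)
  fix s :: real assume s: "s \<ge> 1"
  \<comment> \<open>Along the critical curve q (1 - k/3) is constantly 8/15, so
    \<open>s powr (- q)\<close> depends on the weight only through exp(-c / (1 - k/3)).\<close>
  define c where "c = 8 / 15 * ln s"
  have md: "mean_den j (8 / (5 * (3 - j))) s = s * (1 - (1 - j / 3) * (1 - exp (- c / (1 - j / 3))))"
    if "j < 3" for j
  proof -
    have "- (8 / (5 * (3 - j))) * ln s = - c / (1 - j / 3)"
      using that by (simp add: c_def field_simps)
    then have "s powr (- (8 / (5 * (3 - j)))) = exp (- c / (1 - j / 3))"
      using s by (simp add: powr_def)
    moreover have "s powr (1 - 8 / (5 * (3 - j))) = s * s powr (- (8 / (5 * (3 - j))))"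
      using s powr_add [of s 1 "- (8 / (5 * (3 - j)))"] by simp
    ultimately show ?thesis by (simp add: mean_den_def algebra_simps)
  qed
  have "(1 - k' / 3) * (1 - exp (- c / (1 - k' / 3))) \<le> (1 - k / 3) * (1 - exp (- c / (1 - k / 3)))"
    using assms s by (intro mult_one_minus_exp_mono) (auto simp: c_def)
  then show "mean_den k (8 / (5 * (3 - k))) s \<le> mean_den k' (8 / (5 * (3 - k'))) s"
    using assms s md [of k] md [of k'] by (smt (verit) mult_left_mono)
qed (use assms in auto)

section \<open>From the sign of \<open>crit\<close> to the inequality for sinh x / x\<close>

lemma sinh_over_self_tendsto_1: "((\<lambda>x::real. sinh x / x) \<longlongrightarrow> 1) (at_right 0)"
proof -
  have "((sinh :: real \<Rightarrow> real) has_real_derivative 1) (at 0)"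
    by (auto intro!: derivative_eq_intros)
  then have "((\<lambda>x::real. sinh x / x) \<longlongrightarrow> 1) (at 0)"
    by (simp add: DERIV_def)
  then show ?thesis
    by (rule tendsto_within_subset) auto
qed

lemma cosh_real_gt_1: "x > 0 \<Longrightarrow> cosh x > (1::real)"
  using cosh_real_nonneg_less_iff [of 0 x] by simp

text \<open>Taking \<open>\<sigma>\<close> as 1 or -1 treats both directions at once, and the bound
  \<open>T\<close> allows global as well as local use. The hypothesis \<open>den\<close> says that
  the denominator \<open>D\<close> is positive.\<close>

lemma sinh_mean_den_quotient_sign:
  assumes k: "0 \<le> k" "k < 3"
    and crit: "\<And>t. 1 < t \<Longrightarrow> t < T \<Longrightarrow> 0 < \<sigma> * crit k q t"
    and den: "\<And>t. 1 \<le> t \<Longrightarrow> t < T \<Longrightarrow> t\<^sup>2 - 1 < 3 * t * mean_den k q t"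
    and x: "x > 0" "cosh x < T"
  shows "0 < \<sigma> * (3 * sinh x * mean_den k q (cosh x)
                    / (3 * cosh x * mean_den k q (cosh x) - (sinh x)\<^sup>2) - x)"
proof -
  define P where "P = (\<lambda>y. mean_den k q (cosh y))"
  define P' where "P' = (\<lambda>y. mean_den_deriv k q (cosh y))"
  define D where "D = (\<lambda>y. 3 * cosh y * P y - (sinh y)\<^sup>2)"
  define g where "g = (\<lambda>y. \<sigma> * (3 * sinh y * P y / D y - y))"
  have coshT: "cosh y < T" if "0 \<le> y" "y \<le> x" for y
    using that x cosh_real_nonneg_le_iff [of y x] by linarith
  have Dpos: "D y > 0" if "0 \<le> y" "y \<le> x" for y
    using den [OF cosh_real_ge_1 coshT [OF that]] sinh_square_eq [of y] by (simp add: D_def P_def)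
  have dP: "(P has_real_derivative P' y * sinh y) (at y)" for y
    unfolding P_def P'_def
    by (rule DERIV_chain2 [OF DERIV_mean_den]) (auto intro!: derivative_eq_intros)
  have dg: "(g has_real_derivative \<sigma> * ((sinh y)\<^sup>2 * crit k q (cosh y) / (D y)\<^sup>2)) (at y)"
    if "0 \<le> y" "y \<le> x" for y
  proof -
    define s c p p' where "s = sinh y" and "c = cosh y" and "p = P y" and "p' = P' y"
    have c2: "c\<^sup>2 = s\<^sup>2 + 1" by (simp add: s_def c_def cosh_square_eq)
    have Dy: "D y = 3 * c * p - s\<^sup>2" by (simp add: D_def s_def c_def p_def)
    have nz: "D y \<noteq> 0" using Dpos [OF that] by simp
    have "(g has_real_derivative
        \<sigma> * (((3 * c * p + 3 * s * (p' * s)) * D y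
              - 3 * s * p * (3 * s * p + 3 * c * (p' * s) - 2 * s * c)) / (D y * D y) - 1)) (at y)"
      unfolding g_def using nz
      by (auto intro!: derivative_eq_intros dP simp: D_def s_def c_def p_def p'_def)
        (simp_all add: algebra_simps)
    \<comment> \<open>In the quotient rule numerator minus D^2, the terms in c^2 p^2 and in c p p'
      s^2 cancel, and s^2 factors out of the rest.\<close>
    moreover have "(3 * c * p + 3 * s * (p' * s)) * (3 * c * p - s\<^sup>2)
              - 3 * s * p * (3 * s * p + 3 * c * (p' * s) - 2 * s * c) - (3 * c * p - s\<^sup>2)\<^sup>2
            = s\<^sup>2 * crit k q c"
    proof -
      have "crit k q c = 9 * p * (c - p) - s\<^sup>2 * (1 + 3 * p')"
        unfolding crit_def c2 by (simp add: p_def P_def p'_def P'_def c_def)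
      then show ?thesis by algebra
    qed
    then have "((3 * c * p + 3 * s * (p' * s)) * D y
              - 3 * s * p * (3 * s * p + 3 * c * (p' * s) - 2 * s * c)) / (D y * D y) - 1
            = s\<^sup>2 * crit k q c / (D y)\<^sup>2"
      using nz unfolding Dy by (simp add: divide_simps power2_eq_square)
    ultimately show ?thesis by (simp add: s_def c_def)
  qed
  \<comment> \<open>The factor sinh^2 makes the derivative vanish at 0, so positivity is claimed
    only in the open interval, with continuity at its ends.\<close>
  have "g 0 < g x"
  proof (rule DERIV_pos_imp_increasing_open [OF \<open>0 < x\<close>])
    fix y assume y: "0 < y" "y < x"
    have "0 < \<sigma> * crit k q (cosh y)"
      using y by (intro crit coshT) (auto simp: cosh_real_gt_1)
    moreover have "0 < (sinh y)\<^sup>2 / (D y)\<^sup>2"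
      using y Dpos [of y] by simp
    ultimately have "0 < (\<sigma> * crit k q (cosh y)) * ((sinh y)\<^sup>2 / (D y)\<^sup>2)"
      by (rule mult_pos_pos)
    then have "0 < \<sigma> * ((sinh y)\<^sup>2 * crit k q (cosh y) / (D y)\<^sup>2)"
      by (simp add: mult_ac)
    then show "\<exists>d. (g has_real_derivative d) (at y) \<and> 0 < d"
      using dg y by (metis less_eq_real_def)
  next
    show "continuous_on {0..x} g"
      using dg DERIV_isCont by (intro continuous_at_imp_continuous_on) fastforce
  qed
  then show ?thesis
    by (simp add: g_def D_def P_def)
qed

lemma sinh_quotient_sign:
  assumes k: "0 \<le> k" "k < 3"
    and crit: "\<And>t. 1 < t \<Longrightarrow> t < T \<Longrightarrow> 0 < \<sigma> * crit k q t"
    and den: "\<And>t. 1 \<le> t \<Longrightarrow> t < T \<Longrightarrow> t\<^sup>2 - 1 < 3 * t * mean_den k q t"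
    and x: "x > 0" "cosh x < T"
  shows "0 < \<sigma> * (ln (power_expr k q (cosh x)) - ln (sinh x / x))"
proof -
  define f where "f = (\<lambda>x. \<sigma> * (ln (power_expr k q (cosh x)) - ln (sinh x / x)))"
  have inc: "f a < f b" if ab: "0 < a" "a < b" "b \<le> x" for a b
  proof (rule DERIV_pos_imp_increasing [OF \<open>a < b\<close>])
    fix y assume y: "a \<le> y" "y \<le> b"
    define s c p where "s = sinh y" and "c = cosh y" and "p = mean_den k q c"
    have y0: "y > 0" and yx: "y \<le> x" using y ab by auto
    have s: "s > 0" using y0 by (simp add: s_def)
    have c: "c > 1" using y0 by (simp add: c_def cosh_real_gt_1)
    have c2: "c\<^sup>2 = s\<^sup>2 + 1" by (simp add: s_def c_def cosh_square_eq)
    have p: "p > 0" using c k by (auto simp: p_def intro!: mean_den_pos)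
    have cT: "c < T" using yx y0 x cosh_real_nonneg_le_iff [of y x] by (simp add: c_def)
    have D: "3 * c * p - s\<^sup>2 > 0" using den [of c] c cT c2 by (simp add: p_def)
    have "0 < \<sigma> * (3 * s * p / (3 * c * p - s\<^sup>2) - y)"
      using sinh_mean_den_quotient_sign [OF k crit den y0 cT [unfolded c_def]] by (simp add: s_def c_def p_def)
    \<comment> \<open>The positive factor D / (3 s p y) turns the quotient minus \<open>y\<close>
      into the derivative of the difference of the logarithms.\<close>
    then have "0 < \<sigma> * (3 * s * p / (3 * c * p - s\<^sup>2) - y) * ((3 * c * p - s\<^sup>2) / (3 * s * p * y))"
      by (rule mult_pos_pos) (use D s p y0 in simp)
    also have "\<dots> = \<sigma> * (1 / (3 * p) * s - (c * y - s) / y\<^sup>2 / (s / y))"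
      using D s p y0 by (simp add: field_simps power2_eq_square)
    finally have "0 < \<sigma> * (1 / (3 * p) * s - (c * y - s) / y\<^sup>2 / (s / y))" .
    moreover have "(f has_real_derivative \<sigma> * (1 / (3 * p) * s - (c * y - s) / y\<^sup>2 / (s / y))) (at y)"
    proof -
      have "((\<lambda>x. ln (power_expr k q (cosh x))) has_real_derivative 1 / (3 * p) * s) (at y)"
        unfolding p_def c_def s_def
        by (rule DERIV_chain2 [OF DERIV_ln_power_expr]) (auto intro!: derivative_eq_intros k)
      moreover have "((\<lambda>x. ln (sinh x / x)) has_real_derivative (c * y - s) / y\<^sup>2 / (s / y)) (at y)"
        using y0 s unfolding c_def s_def
        by (auto intro!: derivative_eq_intros simp: power2_eq_square)
      ultimately show ?thesis unfolding f_def by (intro DERIV_cmult DERIV_diff)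
    qed
    ultimately show "\<exists>d. (f has_real_derivative d) (at y) \<and> 0 < d" by blast
  qed
  \<comment> \<open>At 0 the quotient \<open>sinh x / x\<close> divides by zero, so a right-hand
    limit replaces the value there.\<close>
  have "(f \<longlongrightarrow> \<sigma> * (ln (power_expr k q (cosh 0)) - ln 1)) (at_right 0)"
  proof -
    have "isCont (\<lambda>t. ln (power_expr k q t)) (cosh 0)"
      by (rule DERIV_isCont [OF DERIV_ln_power_expr]) (auto intro: k)
    then have "((\<lambda>x. ln (power_expr k q (cosh x))) \<longlongrightarrow> ln (power_expr k q (cosh 0))) (at_right 0)"
      by (rule isCont_tendsto_compose) (auto intro!: tendsto_eq_intros)
    moreover have "((\<lambda>x. ln (sinh x / x)) \<longlongrightarrow> ln 1) (at_right (0 :: real))"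
      by (intro tendsto_ln sinh_over_self_tendsto_1) simp
    ultimately show ?thesis
      unfolding f_def by (intro tendsto_mult tendsto_diff tendsto_const)
  qed
  then have "(f \<longlongrightarrow> 0) (at_right 0)"
    by (simp add: power_expr_1)
  \<comment> \<open>The limit yields only a weak inequality; stopping at \<open>x / 2\<close> leaves
    room for a strict increase up to \<open>x\<close>.\<close>
  moreover have "eventually (\<lambda>y. f y \<le> f (x / 2)) (at_right 0)"
    unfolding eventually_at_right_field using inc [of _ "x / 2"] x
    by (intro exI [of _ "x / 2"]) (auto intro: less_imp_le)
  ultimately have "0 \<le> f (x / 2)"
    by (rule tendsto_upperbound) simp
  also have "f (x / 2) < f x" using inc [of "x / 2" x] x by simp
  finally show ?thesis by (simp add: f_def)
qed

lemma sinh_quotient_less: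
  assumes "0 \<le> k" "k < 3"
    and "\<And>t. 1 < t \<Longrightarrow> t < T \<Longrightarrow> 0 < crit k q t"
    and "\<And>t. 1 \<le> t \<Longrightarrow> t < T \<Longrightarrow> t\<^sup>2 - 1 < 3 * t * mean_den k q t"
    and "x > 0" "cosh x < T"
  shows "sinh x / x < power_expr k q (cosh x)"
  using sinh_quotient_sign [of k T 1 q x] assms power_expr_pos [of k "cosh x" q] by simp

lemma sinh_quotient_greater:
  assumes "0 \<le> k" "k < 3"
    and "\<And>t. 1 < t \<Longrightarrow> t < T \<Longrightarrow> crit k q t < 0"
    and "\<And>t. 1 \<le> t \<Longrightarrow> t < T \<Longrightarrow> t\<^sup>2 - 1 < 3 * t * mean_den k q t"
    and "x > 0" "cosh x < T"
  shows "power_expr k q (cosh x) < sinh x / x"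
  using sinh_quotient_sign [of k T "-1" q x] assms power_expr_pos [of k "cosh x" q] by simp

section \<open>Sufficiency at the boundary parameters\<close>

text \<open>The summand k t / 3 of \<open>mean_den\<close> alone contributes k t^2, which is at
  least t^2.\<close>

lemma den_pos_of_weight:
  assumes "1 \<le> k" "k < 3" "t \<ge> 1"
  shows "t\<^sup>2 - 1 < 3 * t * mean_den k q t"
proof -
  have "t * t \<le> 3 * t * (k / 3 * t)"
    using assms by (simp add: field_simps)
  also have "\<dots> \<le> 3 * t * mean_den k q t"
    unfolding mean_den_def using assms by (intro mult_left_mono) auto
  finally show ?thesis by (simp add: power2_eq_square)
qed

lemma cosh_cube_root_less_sinh_quotient:
  assumes "x > 0"
  shows "power_expr k 0 (cosh x) < sinh x / x"
proof -
  have md: "mean_den 0 0 t = t" if "t \<ge> 1" for t :: real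
    using that by (simp add: mean_den_def)
  \<comment> \<open>For \<open>q = 0\<close> the expression does not depend on \<open>k\<close>, so
    the weight may be taken as 0. Any \<open>T\<close> beyond \<open>cosh x\<close> will do, as the
    sign of \<open>crit\<close> is known for all \<open>t > 1\<close>.\<close>
  have "power_expr 0 0 (cosh x) < sinh x / x"
  proof (rule sinh_quotient_greater [where T = "cosh x + 1"])
    fix t :: real assume t: "1 < t"
    then have "crit 0 0 t = - 4 * (t\<^sup>2 - 1)"
      by (simp add: crit_def md mean_den_deriv_def)
    moreover have "t\<^sup>2 > 1" using t by (simp add: one_less_power)
    ultimately show "crit 0 0 t < 0" by simp
  next
    fix t :: real assume "1 \<le> t"
    moreover have "0 \<le> t * t" by simp
    then have "t * t - 1 < 3 * (t * t)" by linarith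
    ultimately show "t\<^sup>2 - 1 < 3 * t * mean_den 0 0 t"
      by (simp only: md power2_eq_square mult.assoc)
  qed (use assms in auto)
  then show ?thesis by (simp add: power_expr_def)
qed

text \<open>Real powers enter only through \<open>r\<close>; once \<open>t\<close> is a natural
  power of \<open>r\<close>, \<open>crit\<close> is rational in \<open>r\<close>.\<close>

lemma crit_eq:
  assumes "t > 0" "r = t powr (1 - q)"
  shows "crit k q t = 9 * ((1 - k / 3) * r + k / 3 * t) * ((1 - k / 3) * (t - r))
                      - (t\<^sup>2 - 1) * (1 + k + (3 - k) * (1 - q) * r / t)"
proof -
  have "t powr (- q) = r / t"
    using assms powr_add [of t "1 - q" "-1"] by (simp add: powr_minus_divide)
  then have "1 + 3 * mean_den_deriv k q t = 1 + k + (3 - k) * (1 - q) * r / t"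
    by (simp add: mean_den_deriv_def algebra_simps diff_divide_distrib add_divide_distrib)
  moreover have "mean_den k q t = (1 - k / 3) * r + k / 3 * t"
    by (simp add: mean_den_def assms(2))
  moreover have "t - ((1 - k / 3) * r + k / 3 * t) = (1 - k / 3) * (t - r)"
    by (simp add: field_simps)
  ultimately show ?thesis
    by (simp only: crit_def)
qed

text \<open>The critical exponent for \<open>k = 1\<close> is 4/5, so t = r^5. Clearing the
  denominator leaves a polynomial in r^2 with a double zero at 1 and a positive cofactor.\<close>

lemma crit_pos_weight_1:
  assumes "t > 1"
  shows "crit 1 (4 / 5) t > 0"
proof -
  define r where "r = t powr (1 / 5)"
  have r: "r > 1" using assms by (simp add: r_def gr_one_powr)
  have t: "t = r ^ 5" using assms by (simp add: r_def powr_power)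
  have "crit 1 (4 / 5) t = 9 * (2 / 3 * r + t / 3) * (2 / 3 * (t - r))
          - (t\<^sup>2 - 1) * (2 + 2 / 5 * r / t)"
    using crit_eq [of t r "4/5" 1] assms by (simp add: r_def)
  then have "5 * r ^ 4 * crit 1 (4 / 5) t
      = 2 * (4 * r ^ 10 - 10 * r ^ 6 + 5 * r ^ 4 + 1)"
    using r unfolding t by (simp add: field_simps power_numeral_reduce)
  also have "\<dots> = 2 * ((r\<^sup>2 - 1)\<^sup>2 * (4 * r ^ 6 + 8 * r ^ 4 + 2 * r\<^sup>2 + 1))"
    by (simp add: algebra_simps power2_eq_square power_numeral_reduce)
  also have "\<dots> > 0"
  proof -
    have "r\<^sup>2 > 1" using r by (simp add: one_less_power)
    moreover have "4 * r ^ 6 + 8 * r ^ 4 + 2 * r\<^sup>2 + 1 > 0" using r by (intro add_pos_pos) auto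
    ultimately show ?thesis by simp
  qed
  finally show ?thesis
    using r by (simp add: zero_less_mult_iff)
qed

text \<open>The polynomial has a triple zero at \<open>1\<close>, so two differentiations leave a quadratic in \<open>y^17\<close>.\<close>

lemma crit_polynomial_pos:
  fixes y :: real
  assumes "y > 1"
  shows "45 * y ^ 52 - 158 * y ^ 35 + 980 * y ^ 18 - 850 * y ^ 17 - 17 > 0"
proof -
  \<comment> \<open>\<open>R\<close> is the derivative of \<open>Q\<close> divided by
    \<open>y ^ 16\<close>; both vanish at 1.\<close>
  define R :: "real \<Rightarrow> real" where "R = (\<lambda>y. 2340 * y ^ 35 - 5530 * y ^ 18 + 17640 * y - 14450)"
  define Q :: "real \<Rightarrow> real"
    where "Q = (\<lambda>y. 45 * y ^ 52 - 158 * y ^ 35 + 980 * y ^ 18 - 850 * y ^ 17 - 17)"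
  have R: "R z > 0" if "z > 1" for z
  proof -
    have "R 1 < R z"
    proof (rule DERIV_pos_imp_increasing_open [OF that])
      fix x :: real assume x: "1 < x"
      have "(R has_real_derivative (81900 * x ^ 34 - 99540 * x ^ 17 + 17640)) (at x)"
        unfolding R_def by (auto intro!: derivative_eq_intros)
      also have "81900 * x ^ 34 - 99540 * x ^ 17 + 17640 = (x ^ 17 - 1) * (81900 * x ^ 17 - 17640)"
        by (simp add: algebra_simps flip: power_add)
      finally have "(R has_real_derivative (x ^ 17 - 1) * (81900 * x ^ 17 - 17640)) (at x)" .
      moreover have "x ^ 17 > 1" using x by (simp add: one_less_power)
      then have "(x ^ 17 - 1) * (81900 * x ^ 17 - 17640) > 0" by (intro mult_pos_pos) auto
      ultimately show "\<exists>d. (R has_real_derivative d) (at x) \<and> 0 < d" by blast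
    qed (auto simp: R_def intro!: continuous_intros)
    then show ?thesis by (simp add: R_def)
  qed
  have "Q 1 < Q y"
  proof (rule DERIV_pos_imp_increasing_open [OF assms])
    fix x :: real assume x: "1 < x"
    have "(Q has_real_derivative (2340 * x ^ 51 - 5530 * x ^ 34 + 17640 * x ^ 17 - 14450 * x ^ 16)) (at x)"
      unfolding Q_def by (auto intro!: derivative_eq_intros)
    also have "2340 * x ^ 51 - 5530 * x ^ 34 + 17640 * x ^ 17 - 14450 * x ^ 16 = x ^ 16 * R x"
      by (simp add: R_def algebra_simps flip: power_add power_Suc power_Suc2)
    finally show "\<exists>d. (Q has_real_derivative d) (at x) \<and> 0 < d"
      using R [OF x] x by (intro exI [of _ "x ^ 16 * R x"] conjI mult_pos_pos) auto
  qed (auto simp: Q_def intro!: continuous_intros)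
  then show ?thesis by (simp add: Q_def)
qed

text \<open>The critical exponent for \<open>k = 23 / 17\<close> is 34/35, so t = r^35. All powers
  of \<open>r\<close> in the bracket are odd; removing one \<open>r\<close> leaves a polynomial in y
  = r^2, whose zero at 1 is triple, against double for \<open>k = 1\<close>.\<close>

lemma crit_neg_weight_23_17:
  assumes "t > 1"
  shows "crit (23 / 17) (34 / 35) t < 0"
proof -
  define r where "r = t powr (1 / 35)"
  have r: "r > 1" using assms by (simp add: r_def gr_one_powr)
  have t: "t = r ^ 35" using assms by (simp add: r_def powr_power)
  have "crit (23 / 17) (34 / 35) t = 9 * (28 / 51 * r + 23 / 51 * t) * (28 / 51 * (t - r))
          - (t\<^sup>2 - 1) * (40 / 17 + 4 / 85 * r / t)"
    using crit_eq [of t r "34/35" "23/17"] assms by (simp add: r_def)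
  also have "\<dots> = - 4 / (1445 * t) * (45 * t ^ 3 - 158 * t\<^sup>2 * r + 980 * t * r\<^sup>2 - 850 * t - 17 * r)"
    using assms by (simp add: field_simps power2_eq_square power3_eq_cube)
  also have "45 * t ^ 3 - 158 * t\<^sup>2 * r + 980 * t * r\<^sup>2 - 850 * t - 17 * r
      = r * (45 * (r\<^sup>2) ^ 52 - 158 * (r\<^sup>2) ^ 35 + 980 * (r\<^sup>2) ^ 18 - 850 * (r\<^sup>2) ^ 17 - 17)"
  proof -
    have "t ^ 3 = r * (r\<^sup>2) ^ 52" "t\<^sup>2 * r = r * (r\<^sup>2) ^ 35" "t * r\<^sup>2 = r * (r\<^sup>2) ^ 18"
      "t = r * (r\<^sup>2) ^ 17"
      unfolding t by (simp_all flip: power_mult power_add power_Suc power_Suc2)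
    then show ?thesis by algebra
  qed
  finally have eq: "crit (23 / 17) (34 / 35) t = - 4 / (1445 * t) *
    (r * (45 * (r\<^sup>2) ^ 52 - 158 * (r\<^sup>2) ^ 35 + 980 * (r\<^sup>2) ^ 18 - 850 * (r\<^sup>2) ^ 17 - 17))" .
  have "r * (45 * (r\<^sup>2) ^ 52 - 158 * (r\<^sup>2) ^ 35 + 980 * (r\<^sup>2) ^ 18 - 850 * (r\<^sup>2) ^ 17 - 17) > 0"
    using r by (intro mult_pos_pos crit_polynomial_pos) (auto simp: one_less_power)
  then show ?thesis
    unfolding eq using assms by (intro mult_neg_pos) (auto simp: divide_neg_pos)
qed

lemma sinh_quotient_less_critical:
  assumes "0 \<le> k" "k \<le> 1" "x > 0"
  shows "sinh x / x < power_expr k (8 / (5 * (3 - k))) (cosh x)"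
proof -
  have "sinh x / x < power_expr 1 (4 / 5) (cosh x)"
    by (rule sinh_quotient_less [where T = "cosh x + 1"])
      (use assms in \<open>auto intro: crit_pos_weight_1 den_pos_of_weight\<close>)
  also have "\<dots> \<le> power_expr k (8 / (5 * (3 - k))) (cosh x)"
    using power_expr_critical_antimono [of k 1 "cosh x"] assms by (simp add: cosh_real_ge_1)
  finally show ?thesis .
qed

lemma sinh_quotient_greater_critical:
  assumes "23 / 17 \<le> k" "k < 3" "x > 0"
  shows "power_expr k (8 / (5 * (3 - k))) (cosh x) < sinh x / x"
proof -
  have "power_expr k (8 / (5 * (3 - k))) (cosh x) \<le> power_expr (23 / 17) (34 / 35) (cosh x)"
    using power_expr_critical_antimono [of "23 / 17" k "cosh x"] assms by (simp add: cosh_real_ge_1)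
  also have "\<dots> < sinh x / x"
    by (rule sinh_quotient_greater [where T = "cosh x + 1"])
      (use assms in \<open>auto intro: crit_neg_weight_23_17 den_pos_of_weight\<close>)
  finally show ?thesis .
qed

section \<open>Sharpness of the critical exponent near x = 0\<close>

text \<open>For \<open>k < 3\<close> this slope changes sign exactly at q = 8 / (5 (3 - k)), which
  identifies the critical exponent.\<close>

lemma DERIV_crit_1: "(crit k q has_real_derivative 5 * q * (3 - k) - 8) (at 1)"
proof -
  have d: "(mean_den k q has_real_derivative (1 - k / 3) * (1 - q) + k / 3) (at 1)"
    using DERIV_mean_den [of 1 k q] by (simp add: mean_den_deriv_def)
  have d': "(mean_den_deriv k q has_real_derivative - q * ((1 - k / 3) * (1 - q))) (at 1)"
    unfolding mean_den_deriv_def by (auto intro!: derivative_eq_intros)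
  show ?thesis
    unfolding crit_def
    by (rule derivative_eq_intros d d' refl | simp)+
      (simp add: mean_den_deriv_def field_simps)
qed

text \<open>At \<open>t = 1\<close> the difference of the two sides is 3, so continuity suffices.
  Unlike \<open>den_pos_of_weight\<close>, this also serves weights below 1.\<close>

lemma near_1_den_pos: "\<exists>T>1. \<forall>t. 1 \<le> t \<longrightarrow> t < T \<longrightarrow> t\<^sup>2 - 1 < 3 * t * mean_den k q t"
proof -
  have "isCont (\<lambda>t. 3 * t * mean_den k q t - (t\<^sup>2 - 1)) 1"
    using DERIV_isCont [OF DERIV_mean_den, of 1 k q] by (intro continuous_intros) auto
  then have "((\<lambda>t. 3 * t * mean_den k q t - (t\<^sup>2 - 1)) \<longlongrightarrow> 3) (at 1)"
    by (simp add: isCont_def)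
  then have "eventually (\<lambda>t. 0 < 3 * t * mean_den k q t - (t\<^sup>2 - 1)) (at 1)"
    by (rule order_tendstoD) simp
  then obtain d where d: "d > 0"
    "\<And>t. t \<noteq> 1 \<Longrightarrow> dist t 1 < d \<Longrightarrow> 0 < 3 * t * mean_den k q t - (t\<^sup>2 - 1)"
    unfolding eventually_at by blast
  show ?thesis
  proof (intro exI [of _ "1 + d"] conjI allI impI)
    fix t assume t: "1 \<le> t" "t < 1 + d"
    show "t\<^sup>2 - 1 < 3 * t * mean_den k q t"
      using d(2) [of t] t by (cases "t = 1") (auto simp: dist_real_def)
  qed (use d in auto)
qed

lemma exists_cosh_less:
  assumes "T > 1"
  shows "\<exists>x>0. cosh x < (T::real)"
proof -
  have "cosh (arcosh ((1 + T) / 2)) = (1 + T) / 2"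
    using assms by (intro cosh_arcosh_real) auto
  moreover have "arcosh ((1 + T) / 2) > 0"
    using assms by simp
  ultimately show ?thesis
    using assms by (intro exI [of _ "arcosh ((1 + T) / 2)"]) auto
qed

text \<open>Above the critical exponent \<open>crit\<close> rises from its value 0 at
  \<open>t = 1\<close>, so the sign criterion applies on a short interval to the right of 1.\<close>

lemma exists_sinh_quotient_less:
  assumes "0 \<le> k" "k < 3" "q > 8 / (5 * (3 - k))"
  shows "\<exists>x>0. sinh x / x < power_expr k q (cosh x)"
proof -
  have "5 * q * (3 - k) - 8 > 0" using assms by (simp add: field_simps)
  then obtain d where d: "d > 0" "\<And>h. 0 < h \<Longrightarrow> h < d \<Longrightarrow> crit k q 1 < crit k q (1 + h)"
    using DERIV_pos_inc_right [OF DERIV_crit_1] by blast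
  obtain T where T: "T > 1" "\<And>t. 1 \<le> t \<Longrightarrow> t < T \<Longrightarrow> t\<^sup>2 - 1 < 3 * t * mean_den k q t"
    using near_1_den_pos by blast
  obtain x :: real where x: "x > 0" "cosh x < min T (1 + d)"
    using exists_cosh_less [of "min T (1 + d)"] T d by auto
  have "sinh x / x < power_expr k q (cosh x)"
  proof (rule sinh_quotient_less [OF assms(1,2) _ _ x])
    fix t assume "1 < t" "t < min T (1 + d)"
    then show "0 < crit k q t" using d(2) [of "t - 1"] by (simp add: crit_def)
  qed (use T in auto)
  with x show ?thesis by blast
qed

lemma exists_sinh_quotient_greater:
  assumes "0 \<le> k" "k < 3" "q < 8 / (5 * (3 - k))"
  shows "\<exists>x>0. power_expr k q (cosh x) < sinh x / x"
proof -
  have "5 * q * (3 - k) - 8 < 0" using assms by (simp add: field_simps)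
  then obtain d where d: "d > 0" "\<And>h. 0 < h \<Longrightarrow> h < d \<Longrightarrow> crit k q 1 > crit k q (1 + h)"
    using DERIV_neg_dec_right [OF DERIV_crit_1] by blast
  obtain T where T: "T > 1" "\<And>t. 1 \<le> t \<Longrightarrow> t < T \<Longrightarrow> t\<^sup>2 - 1 < 3 * t * mean_den k q t"
    using near_1_den_pos by blast
  obtain x :: real where x: "x > 0" "cosh x < min T (1 + d)"
    using exists_cosh_less [of "min T (1 + d)"] T d by auto
  have "power_expr k q (cosh x) < sinh x / x"
  proof (rule sinh_quotient_greater [OF assms(1,2) _ _ x])
    fix t assume "1 < t" "t < min T (1 + d)"
    then show "crit k q t < 0" using d(2) [of "t - 1"] by (simp add: crit_def)
  qed (use T in auto)
  with x show ?thesis by blast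
qed

section \<open>Failure of the lower bound for positive exponents, away from x = 0\<close>

lemma exists_sinh_quotient_less_of_pos_exponent:
  assumes "0 \<le> k" "k \<le> 1" "q > 0"
  shows "\<exists>x>0. sinh x / x < power_expr k q (cosh x)"
proof -
  \<comment> \<open>since \<open>power_expr 1 q t \<ge> 3 powr (- 1 / q) * t\<close>, the inequality already holds once \<open>1 / x \<le> 3 powr (- 1 / q)\<close>\<close>
  define x where "x = (3::real) powr (1 / q)"
  have x: "x > 0" by (simp add: x_def)
  have "sinh x / x < cosh x / x"
    using x sinh_less_cosh_real by (intro divide_strict_right_mono) auto
  also have "cosh x / x = (cosh x powr q / 3) powr (1 / q)"
    using assms by (simp add: x_def powr_divide powr_powr)
  also have "\<dots> \<le> (2 / 3 + cosh x powr q / 3) powr (1 / q)"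
    using assms by (intro powr_mono2) auto
  also have "\<dots> = power_expr 1 q (cosh x)"
    using assms by (simp add: power_expr_def)
  also have "\<dots> \<le> power_expr k q (cosh x)"
    using assms by (intro power_expr_antimono_weight) (auto simp: cosh_real_ge_1)
  finally show ?thesis using x by blast
qed

section \<open>The two equivalences, assembled from boundary cases and counterexamples\<close>

theorem theorem4:
  fixes k q q1 q2 :: real
  assumes "0 \<le> k" and "k < 3"
  shows "(23 / 17 \<le> k \<longrightarrow>
            ((\<forall>x>0. sinh x / x > power_expr k q (cosh x)) \<longleftrightarrow> q \<le> 8 / (5 * (3 - k)))) \<and>
         (k \<le> 1 \<longrightarrow>
            ((\<forall>x>0. power_expr k q1 (cosh x) < sinh x / x \<and>
                    sinh x / x < power_expr k q2 (cosh x)) \<longleftrightarrow>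
             q1 \<le> 0 \<and> q2 \<ge> 8 / (5 * (3 - k))))"
proof (intro conjI impI)
  assume k: "23 / 17 \<le> k"
  show "(\<forall>x>0. sinh x / x > power_expr k q (cosh x)) \<longleftrightarrow> q \<le> 8 / (5 * (3 - k))"
  proof
    assume "\<forall>x>0. sinh x / x > power_expr k q (cosh x)"
    then show "q \<le> 8 / (5 * (3 - k))"
      using exists_sinh_quotient_less [OF assms, of q] by (meson not_le less_asym)
  next
    assume "q \<le> 8 / (5 * (3 - k))"
    then show "\<forall>x>0. sinh x / x > power_expr k q (cosh x)"
      using power_expr_mono_exponent [OF assms] sinh_quotient_greater_critical [OF k assms(2)]
      by (meson cosh_real_ge_1 le_less_trans)
  qed
next
  assume k: "k \<le> 1"
  show "(\<forall>x>0. power_expr k q1 (cosh x) < sinh x / x \<and> sinh x / x < power_expr k q2 (cosh x))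
          \<longleftrightarrow> q1 \<le> 0 \<and> q2 \<ge> 8 / (5 * (3 - k))"
  proof (intro iffI conjI)
    assume *: "\<forall>x>0. power_expr k q1 (cosh x) < sinh x / x \<and> sinh x / x < power_expr k q2 (cosh x)"
    show "q1 \<le> 0"
      using * exists_sinh_quotient_less_of_pos_exponent [OF assms(1) k, of q1]
      by (meson not_le less_asym)
    show "q2 \<ge> 8 / (5 * (3 - k))"
      using * exists_sinh_quotient_greater [OF assms, of q2] by (meson not_le less_asym)
  next
    assume *: "q1 \<le> 0 \<and> q2 \<ge> 8 / (5 * (3 - k))"
    \<comment> \<open>Monotonicity in the exponent reduces the lower bound to exponent 0 and the
      upper bound to the critical exponent.\<close>
    show "\<forall>x>0. power_expr k q1 (cosh x) < sinh x / x \<and> sinh x / x < power_expr k q2 (cosh x)"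
      using * power_expr_mono_exponent [OF assms] cosh_cube_root_less_sinh_quotient
        sinh_quotient_less_critical [OF assms(1) k]
      by (meson cosh_real_ge_1 le_less_trans less_le_trans)
  qed
qed

end
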